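(* Let $r,s>0$ be integers, let $A,B,\Lambda\in\mathbb{C}[u,v]$, and write $\{f,g\}=f_ug_v-f_vg_u$. Then $$\{B\Lambda^{r},\,A\Lambda^{s}\}=\Lambda^{\,r+s-1}\Bigl[\Lambda\{B,A\}+sA\{B,\Lambda\}+rB\{\Lambda,A\}\Bigr].$$ Consequently, if $A\in V_A$ and $B\in V_B$, the polynomial map $$G=\bigl(x^{-s}A(u,v),\;x^{-r}B(u,v),\;x\Lambda(u,v)\bigr)\colon\mathbb{C}^3\to\mathbb{C}^3,\qquad u=x^ry,\ v=x^sz,$$ is a Keller map if and only if $$\Lambda\{B,A\}+sA\{B,\Lambda\}+rB\{\Lambda,A\}=\kappa\qquad\text{for some }\kappa\in\mathbb{C}^\times.$$
   Context: $V_A=\mathrm{span}_{\mathbb{C}}\{u^iv^j: ri+sj\ge s\}$ and $V_B=\mathrm{span}_{\mathbb{C}}\{u^iv^j: ri+sj\ge r\}$ (with $i,j\ge0$); these conditions say exactly that $x^{-s}A(x^ry,x^sz)$ and $x^{-r}B(x^ry,x^sz)$ are polynomials in $x,y,z$. Maps of this form are exactly the polynomial maps equivariant for $\sigma_t(x,y,z)=(tx,t^{-r}y,t^{-s}z)$ on the source and $\tau_t(a,b,c)=(t^{-s}a,t^{-r}b,tc)$ on the target. A Keller map is a polynomial map whose Jacobian determinant is a nonzero constant. *)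

theory Defs
  imports "HOL-Analysis.Analysis" "HOL-Computational_Algebra.Polynomial"
begin

text \<open>
  The ring \<open>\<complex>[u,v]\<close> is rendered as \<open>(\<complex>[u])[v]\<close>, i.e. \<open>complex poly poly\<close>: the inner variable
  is \<open>u\<close>, the outer variable is \<open>v\<close>, and \<open>u\<^sup>i v\<^sup>j\<close> is \<open>monom (monom 1 i) j\<close>.
  Likewise \<open>\<complex>[x,y,z]\<close> is \<open>((\<complex>[x])[y])[z]\<close>.
\<close>

definition eval2 :: "complex poly poly \<Rightarrow> complex \<Rightarrow> complex \<Rightarrow> complex" where
  "eval2 f u v = poly (poly f [:v:]) u"

definition eval3 :: "complex poly poly poly \<Rightarrow> complex ^ 3 \<Rightarrow> complex" where
  "eval3 P p = poly (poly (poly P [:[:p $ 3:]:]) [:p $ 2:]) (p $ 1)"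

definition du :: "complex poly poly \<Rightarrow> complex poly poly" where
  "du f = map_poly pderiv f"

definition dv :: "complex poly poly \<Rightarrow> complex poly poly" where
  "dv f = pderiv f"

definition bracket :: "complex poly poly \<Rightarrow> complex poly poly \<Rightarrow> complex poly poly" where
  "bracket f g = du f * dv g - dv f * du g"

interpretation poly2: vector_space "\<lambda>(c::complex) (f::complex poly poly). smult [:c:] f"
  by unfold_locales (simp_all add: smult_add_right smult_add_left[symmetric] one_pCons[symmetric] mult.commute)

definition V_A :: "nat \<Rightarrow> nat \<Rightarrow> complex poly poly set" where
  "V_A r s = poly2.span {monom (monom 1 i) j | i j. r * i + s * j \<ge> s}"

definition V_B :: "nat \<Rightarrow> nat \<Rightarrow> complex poly poly set" where
  "V_B r s = poly2.span {monom (monom 1 i) j | i j. r * i + s * j \<ge> r}"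

definition polynomial_map :: "(complex ^ 3 \<Rightarrow> complex ^ 3) \<Rightarrow> bool" where
  "polynomial_map F \<longleftrightarrow> (\<forall>i. \<exists>P. \<forall>p. F p $ i = eval3 P p)"

definition jacobian_matrix :: "(complex ^ 3 \<Rightarrow> complex ^ 3) \<Rightarrow> complex ^ 3 \<Rightarrow> complex ^ 3 ^ 3" where
  "jacobian_matrix F p = (\<chi> i j. deriv (\<lambda>t. F (p + t *s axis j 1) $ i) 0)"

definition keller_map :: "(complex ^ 3 \<Rightarrow> complex ^ 3) \<Rightarrow> bool" where
  "keller_map F \<longleftrightarrow> polynomial_map F \<and> (\<exists>c. c \<noteq> 0 \<and> (\<forall>p. det (jacobian_matrix F p) = c))"

text \<open>
  \<open>G = (x\<^sup>-\<^sup>s A(u,v), x\<^sup>-\<^sup>r B(u,v), x \<Lambda>(u,v))\<close> with \<open>u = x\<^sup>r y\<close>, \<open>v = x\<^sup>s z\<close>, as an identity of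
  polynomials. The formula with negative powers makes pointwise sense only for \<open>x \<noteq> 0\<close>; being a
  polynomial map, \<open>G\<close> is determined by its values there.
\<close>

definition is_map_G ::
  "nat \<Rightarrow> nat \<Rightarrow> complex poly poly \<Rightarrow> complex poly poly \<Rightarrow> complex poly poly
    \<Rightarrow> (complex ^ 3 \<Rightarrow> complex ^ 3) \<Rightarrow> bool" where
  "is_map_G r s A B L G \<longleftrightarrow> polynomial_map G \<and>
    (\<forall>x y z. x \<noteq> 0 \<longrightarrow>
      (let u = x ^ r * y; v = x ^ s * z in
        G (vector [x, y, z]) =
          vector [x powi (- int s) * eval2 A u v, x powi (- int r) * eval2 B u v, x * eval2 L u v]))"

end

theory Submission
  imports Defs
begin

text \<open>
  The bracket identity is the Leibniz rule: \<open>du\<close> and \<open>dv\<close> are derivations, and in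
  \<open>{B \<Lambda>\<^sup>r, A \<Lambda>\<^sup>s}\<close> the term containing \<open>{\<Lambda>, \<Lambda>}\<close> vanishes, so that every remaining term carries
  a factor \<open>\<Lambda>\<^bsup>r+s-1\<^esup>\<close>.

  For the Keller criterion, each component of \<open>G\<close> has the form \<open>x\<^sup>n f(u,v)\<close> with \<open>(n,f)\<close> one of
  \<open>(-s,A)\<close>, \<open>(-r,B)\<close>, \<open>(1,\<Lambda>)\<close>, and
  \<open>d(x\<^sup>n f) = x\<^sup>n (n f dx/x + f\<^sub>u du + f\<^sub>v dv)\<close>, where \<open>du\<close> and \<open>dv\<close> are now the differentials of
  \<open>u = x\<^sup>r y\<close> and \<open>v = x\<^sup>s z\<close>. The three prefactors multiply to \<open>x\<^bsup>1-r-s\<^esup>\<close>, while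
  \<open>dx/x \<and> du \<and> dv = x\<^bsup>r+s-1\<^esup> dx \<and> dy \<and> dz\<close>, so the powers of \<open>x\<close> cancel and the Jacobian determinant
  at \<open>(x,y,z)\<close> is the determinant of the matrix with rows \<open>(n f, f\<^sub>u, f\<^sub>v)\<close>, which equals
  \<open>-(\<Lambda>{B,A} + s A {B,\<Lambda>} + r B {\<Lambda>,A})\<close> at \<open>(u,v)\<close> (\<open>det_weighted_rows\<close>).

  This computation needs \<open>x \<noteq> 0\<close>. Both sides are polynomial functions of \<open>(x,y,z)\<close>, and two such
  functions that agree for \<open>x \<noteq> 0\<close> agree everywhere (\<open>polyfun_eq_off_hyperplane\<close>); the same
  principle gives the uniqueness of \<open>G\<close>. On the slice \<open>x = 1\<close> one has \<open>(u,v) = (y,z)\<close>, so the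
  determinant is constant only if the bracket expression is a constant polynomial
  (\<open>eval2_inject\<close>).
\<close>

section \<open>Bivariate polynomials and their derivations\<close>

lemma eval2_0 [simp]: "eval2 0 u v = 0"
  by (simp add: eval2_def)

lemma eval2_pCons [simp]: "eval2 (pCons a f) u v = poly a u + v * eval2 f u v"
  by (simp add: eval2_def)

lemma eval2_add [simp]: "eval2 (f + g) u v = eval2 f u v + eval2 g u v"
  by (simp add: eval2_def)

lemma eval2_diff [simp]: "eval2 (f - g) u v = eval2 f u v - eval2 g u v"
  by (simp add: eval2_def)

lemma eval2_mult [simp]: "eval2 (f * g) u v = eval2 f u v * eval2 g u v"
  by (simp add: eval2_def)

lemma eval2_of_nat [simp]: "eval2 (of_nat n) u v = of_nat n"
  by (simp add: eval2_def)

lemma eval2_smult [simp]: "eval2 (smult a f) u v = poly a u * eval2 f u v"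
  by (simp add: eval2_def)

lemma eval2_monom [simp]: "eval2 (monom (monom 1 i) j) u v = u ^ i * v ^ j"
  by (simp add: eval2_def poly_monom)

lemma eval2_eq_poly_map_poly: "eval2 f u v = poly (map_poly (\<lambda>a. poly a u) f) v"
  by (induction f) (simp_all add: map_poly_pCons)

text \<open>
  Over an infinite field a polynomial is determined by its values: for fixed \<open>u\<close> all coefficients
  with respect to \<open>v\<close> agree, and these are polynomials in \<open>u\<close> that agree everywhere.
\<close>

lemma eval2_inject:
  assumes "\<And>u v. eval2 f u v = eval2 g u v"
  shows "f = g"
proof -
  have "map_poly (\<lambda>a. poly a u) (f - g) = 0" for u
    using assms by (subst poly_all_0_iff_0[symmetric]) (simp flip: eval2_eq_poly_map_poly)
  then have "poly (coeff (f - g) k) u = 0" for k u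
    by (metis coeff_0 coeff_map_poly poly_0)
  then have "coeff (f - g) k = 0" for k
    using poly_all_0_iff_0 by blast
  then have "f - g = 0"
    by (intro poly_eqI) simp
  then show ?thesis
    by simp
qed

lemma du_0 [simp]: "du 0 = 0"
  by (simp add: du_def)

lemma du_pCons [simp]: "du (pCons a f) = pCons (pderiv a) (du f)"
  by (simp add: du_def map_poly_pCons)

lemma du_add: "du (f + g) = du f + du g"
  by (intro poly_eqI) (simp add: du_def coeff_map_poly pderiv_add)

lemma du_smult: "du (smult a f) = smult (pderiv a) f + smult a (du f)"
  by (intro poly_eqI) (simp add: du_def coeff_map_poly pderiv_mult algebra_simps)

lemma du_mult: "du (f * g) = du f * g + f * du g"
  by (induction f) (simp_all add: du_add du_smult algebra_simps)

lemma du_power_Suc: "du (f ^ Suc n) = of_nat (Suc n) * f ^ n * du f"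
proof (induction n)
  case 0
  then show ?case by simp
next
  case (Suc n)
  have "du (f ^ Suc (Suc n)) = du f * f ^ Suc n + f * du (f ^ Suc n)"
    by (subst power_Suc, rule du_mult)
  then show ?case
    by (simp only: Suc.IH) (simp add: algebra_simps)
qed

lemma dv_mult: "dv (f * g) = dv f * g + f * dv g"
  by (simp add: dv_def pderiv_mult algebra_simps)

lemma dv_power_Suc: "dv (f ^ Suc n) = of_nat (Suc n) * f ^ n * dv f"
  unfolding dv_def by (subst pderiv_power_Suc) (simp add: of_nat_poly algebra_simps)

lemma bracket_mult_power:
  assumes "r > 0" and "s > 0"
  shows "bracket (B * L ^ r) (A * L ^ s) =
    L ^ (r + s - 1) * (L * bracket B A + of_nat s * A * bracket B L + of_nat r * B * bracket L A)"
proof -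
  obtain m n where rs: "r = Suc m" "s = Suc n"
    using assms by (metis Suc_pred)
  \<comment> \<open>Naming the two integer coefficients keeps them from being split into successors.\<close>
  define a b :: "complex poly poly" where "a = of_nat r" and "b = of_nat s"
  have "du (L ^ r) = a * L ^ m * du L" "dv (L ^ r) = a * L ^ m * dv L"
    "du (L ^ s) = b * L ^ n * du L" "dv (L ^ s) = b * L ^ n * dv L"
    unfolding a_def b_def rs by (rule du_power_Suc dv_power_Suc)+
  moreover have "L ^ r = L * L ^ m" "L ^ s = L * L ^ n" "L ^ (r + s - 1) = L * L ^ m * L ^ n"
    by (simp_all add: rs power_add)
  ultimately show ?thesis
    unfolding bracket_def du_mult dv_mult a_def[symmetric] b_def[symmetric]
    by (simp only:) (simp add: algebra_simps)
qed

text \<open>The chain rule along a curve identifies the formal \<open>du\<close>, \<open>dv\<close> with analytic derivatives.\<close>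

lemma has_field_derivative_eval2:
  assumes U: "(U has_field_derivative U') (at t)" and V: "(V has_field_derivative V') (at t)"
  shows "((\<lambda>t. eval2 f (U t) (V t)) has_field_derivative
    eval2 (du f) (U t) (V t) * U' + eval2 (dv f) (U t) (V t) * V') (at t)"
proof (induction f)
  case 0
  then show ?case by (simp add: dv_def)
next
  case (pCons a f)
  have "((\<lambda>t. poly a (U t)) has_field_derivative poly (pderiv a) (U t) * U') (at t)"
    using DERIV_chain2[OF poly_DERIV U] .
  from DERIV_add[OF this DERIV_mult[OF V pCons.IH]] show ?case
    by (simp add: dv_def pderiv_pCons algebra_simps)
qed

section \<open>Polynomial functions of three variables\<close>

definition polyfun :: "(complex ^ 3 \<Rightarrow> complex) \<Rightarrow> bool" where
  "polyfun f \<longleftrightarrow> (\<exists>P. \<forall>p. f p = eval3 P p)"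

lemma polynomial_map_iff_polyfun: "polynomial_map F \<longleftrightarrow> (\<forall>i. polyfun (\<lambda>p. F p $ i))"
  by (simp add: polynomial_map_def polyfun_def)

lemma polyfun_const [simp]: "polyfun (\<lambda>p. c)"
  unfolding polyfun_def by (rule exI[of _ "[:[:[:c:]:]:]"]) (simp add: eval3_def)

lemma polyfun_coord [simp]: "polyfun (\<lambda>p. p $ i)"
proof -
  have "polyfun (\<lambda>p. p $ 1)"
    unfolding polyfun_def by (rule exI[of _ "[:[:[:0, 1:]:]:]"]) (simp add: eval3_def)
  moreover have "polyfun (\<lambda>p. p $ 2)"
    unfolding polyfun_def by (rule exI[of _ "[:[:0, 1:]:]"]) (simp add: eval3_def)
  moreover have "polyfun (\<lambda>p. p $ 3)"
    unfolding polyfun_def by (rule exI[of _ "[:0, 1:]"]) (simp add: eval3_def)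
  ultimately show ?thesis
    using exhaust_3[of i] by auto
qed

lemma polyfun_add: "polyfun f \<Longrightarrow> polyfun g \<Longrightarrow> polyfun (\<lambda>p. f p + g p)"
  unfolding polyfun_def by (elim exE, rule_tac x = "P + Pa" in exI) (simp add: eval3_def)

lemma polyfun_mult: "polyfun f \<Longrightarrow> polyfun g \<Longrightarrow> polyfun (\<lambda>p. f p * g p)"
  unfolding polyfun_def by (elim exE, rule_tac x = "P * Pa" in exI) (simp add: eval3_def)

lemma polyfun_uminus: "polyfun f \<Longrightarrow> polyfun (\<lambda>p. - f p)"
  using polyfun_mult[of "\<lambda>p. -1" f] by simp

lemma polyfun_diff: "polyfun f \<Longrightarrow> polyfun g \<Longrightarrow> polyfun (\<lambda>p. f p - g p)"
  using polyfun_add[of f "\<lambda>p. - g p"] polyfun_uminus[of g] by simp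

lemma polyfun_power: "polyfun f \<Longrightarrow> polyfun (\<lambda>p. f p ^ n)"
  by (induction n) (auto simp: polyfun_mult)

lemma polyfun_poly:
  assumes "polyfun f"
  shows "polyfun (\<lambda>p. poly a (f p))"
  by (induction a) (simp_all add: polyfun_add polyfun_mult assms)

lemma polyfun_eval2:
  assumes "polyfun f" and "polyfun g"
  shows "polyfun (\<lambda>p. eval2 h (f p) (g p))"
  by (induction h) (simp_all add: polyfun_add polyfun_mult polyfun_poly assms)

text \<open>
  It suffices to produce polynomial functions from constants and coordinates by sums and products:
  peeling off one coefficient at a time from the outermost, middle and innermost variable reaches
  every \<open>eval3 P\<close>.
\<close>

lemma polyfun_induct [consumes 1, case_names const coord add mult]:
  assumes "polyfun f"
    and const: "\<And>c. Q (\<lambda>p. c)"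
    and coord: "\<And>i. Q (\<lambda>p. p $ i)"
    and add: "\<And>f g. polyfun f \<Longrightarrow> polyfun g \<Longrightarrow> Q f \<Longrightarrow> Q g \<Longrightarrow> Q (\<lambda>p. f p + g p)"
    and mult: "\<And>f g. polyfun f \<Longrightarrow> polyfun g \<Longrightarrow> Q f \<Longrightarrow> Q g \<Longrightarrow> Q (\<lambda>p. f p * g p)"
  shows "Q f"
proof -
  note closed = const coord add mult polyfun_add polyfun_mult
  have inner: "polyfun (\<lambda>p. poly a (p $ 1)) \<and> Q (\<lambda>p. poly a (p $ 1))" for a
    by (induction a) (simp_all add: closed)
  have middle: "polyfun (\<lambda>p. poly (poly b [:p $ 2:]) (p $ 1)) \<and>
      Q (\<lambda>p. poly (poly b [:p $ 2:]) (p $ 1))" for b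
    by (induction b) (simp_all add: closed inner)
  have "polyfun (eval3 P) \<and> Q (eval3 P)" for P
    unfolding eval3_def by (induction P) (simp_all add: closed middle)
  moreover obtain P where "f = eval3 P"
    using assms(1) unfolding polyfun_def by blast
  ultimately show ?thesis
    by simp
qed

text \<open>
  Polynomial functions are differentiable with polynomial derivatives, also on the plane \<open>x = 0\<close>,
  where the formula for \<open>G\<close> is unavailable; hence the Jacobian determinant of a polynomial map is
  itself a polynomial function.
\<close>

lemma polyfun_directional_derivative:
  assumes "polyfun f"
  shows "\<exists>g. polyfun g \<and> (\<forall>p. ((\<lambda>t. f (p + t *s w)) has_field_derivative g p) (at 0))"
  using assms
proof (induction rule: polyfun_induct)
  case (const c)
  show ?case
    by (intro exI[of _ "\<lambda>p. 0"]) simp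
next
  case (coord i)
  show ?case
    by (intro exI[of _ "\<lambda>p. w $ i"]) (auto intro!: derivative_eq_intros)
next
  case (add f g)
  then obtain f' g' where "polyfun f'" "polyfun g'"
    "\<forall>p. ((\<lambda>t. f (p + t *s w)) has_field_derivative f' p) (at 0)"
    "\<forall>p. ((\<lambda>t. g (p + t *s w)) has_field_derivative g' p) (at 0)"
    by blast
  then show ?case
    by (intro exI[of _ "\<lambda>p. f' p + g' p"]) (auto intro: DERIV_add polyfun_add)
next
  case (mult f g)
  then obtain f' g' where poly: "polyfun f" "polyfun g" "polyfun f'" "polyfun g'"
    and der: "\<And>p. ((\<lambda>t. f (p + t *s w)) has_field_derivative f' p) (at 0)"
    "\<And>p. ((\<lambda>t. g (p + t *s w)) has_field_derivative g' p) (at 0)"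
    by blast
  have "((\<lambda>t. f (p + t *s w) * g (p + t *s w)) has_field_derivative f' p * g p + g' p * f p) (at 0)"
    for p
    using DERIV_mult[OF der(1)[of p] der(2)[of p]] by simp
  moreover have "polyfun (\<lambda>p. f' p * g p + g' p * f p)"
    by (intro polyfun_add polyfun_mult poly)
  ultimately show ?case
    by blast
qed

lemma polyfun_det_jacobian_matrix:
  assumes "polynomial_map F"
  shows "polyfun (\<lambda>p. det (jacobian_matrix F p))"
proof -
  have entry: "polyfun (\<lambda>p. jacobian_matrix F p $ i $ j)" for i j
  proof -
    have "polyfun (\<lambda>p. F p $ i)"
      using assms by (simp add: polynomial_map_iff_polyfun)
    from polyfun_directional_derivative[OF this, of "axis j 1"] obtain g where
      "polyfun g" and "\<And>p. ((\<lambda>t. F (p + t *s axis j 1) $ i) has_field_derivative g p) (at 0)"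
      by blast
    moreover from this(2) have "jacobian_matrix F p $ i $ j = g p" for p
      unfolding jacobian_matrix_def vec_lambda_beta by (rule DERIV_imp_deriv)
    ultimately show ?thesis
      by simp
  qed
  show ?thesis
    unfolding det_3 by (intro polyfun_add polyfun_diff polyfun_mult entry)
qed

text \<open>
  For fixed \<open>y\<close> and \<open>z\<close> both functions are polynomials in \<open>x\<close> alone, and their difference has
  infinitely many zeros.
\<close>

lemma polyfun_eq_off_hyperplane:
  assumes "polyfun f" and "polyfun g"
    and eq: "\<And>p. p $ 1 \<noteq> 0 \<Longrightarrow> f p = g p"
  shows "f p = g p"
proof -
  obtain P Q where PQ: "f = eval3 P" "g = eval3 Q"
    using assms(1,2) unfolding polyfun_def by blast
  define slice :: "complex poly poly poly \<Rightarrow> complex poly"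
    where "slice R = poly (poly R [:[:p $ 3:]:]) [:p $ 2:]" for R
  have slice: "poly (slice R) x = eval3 R (vector [x, p $ 2, p $ 3])" for R x
    by (simp add: slice_def eval3_def)
  have "poly (slice P - slice Q) x = 0" if "x \<noteq> 0" for x
    using eq[of "vector [x, p $ 2, p $ 3]"] that by (simp add: slice PQ)
  then have "- {0} \<subseteq> {x. poly (slice P - slice Q) x = 0}"
    by auto
  moreover have "infinite (- {0 :: complex})"
    using finite_compl[of "{0 :: complex}"] infinite_UNIV_char_0 by blast
  ultimately have "slice P - slice Q = 0"
    using finite_subset poly_roots_finite by blast
  then have "poly (slice P) (p $ 1) = poly (slice Q) (p $ 1)"
    by simp
  then show ?thesis
    by (simp add: PQ slice_def eval3_def)
qed

section \<open>The equivariant map and its Jacobian\<close>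

text \<open>
  The condition \<open>ri + sj \<ge> n\<close> on the monomials of \<open>f\<close> is what makes \<open>x\<^bsup>-n\<^esup> f(x\<^sup>r y, x\<^sup>s z)\<close> polynomial.
\<close>

lemma weighted_span_divisible:
  assumes "f \<in> poly2.span {monom (monom 1 i) j | i j. r * i + s * j \<ge> n}"
  shows "\<exists>g. polyfun g \<and>
    (\<forall>p. eval2 f (p $ 1 ^ r * p $ 2) (p $ 1 ^ s * p $ 3) = p $ 1 ^ n * g p)"
  using assms
proof (induction rule: poly2.span_induct_alt)
  case base
  show ?case
    by (intro exI[of _ "\<lambda>p. 0"]) simp
next
  case (step c m f)
  then obtain i j where m: "m = monom (monom 1 i) j" and le: "n \<le> r * i + s * j"
    by blast
  from step obtain g where g: "polyfun g"
    "\<And>p. eval2 f (p $ 1 ^ r * p $ 2) (p $ 1 ^ s * p $ 3) = p $ 1 ^ n * g p"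
    by blast
  define h where "h p = c * (p $ 1 ^ (r * i + s * j - n) * (p $ 2 ^ i * p $ 3 ^ j)) + g p"
    for p :: "complex ^ 3"
  have "polyfun h"
    unfolding h_def by (intro polyfun_add polyfun_mult polyfun_power polyfun_const polyfun_coord g)
  moreover have "eval2 (smult [:c:] m + f) (p $ 1 ^ r * p $ 2) (p $ 1 ^ s * p $ 3) = p $ 1 ^ n * h p"
    for p
  proof -
    have "p $ 1 ^ (r * i) * p $ 1 ^ (s * j) = p $ 1 ^ n * p $ 1 ^ (r * i + s * j - n)"
      using le by (simp flip: power_add)
    moreover have "(p $ 1 ^ r * p $ 2) ^ i * (p $ 1 ^ s * p $ 3) ^ j
        = (p $ 1 ^ (r * i) * p $ 1 ^ (s * j)) * (p $ 2 ^ i * p $ 3 ^ j)"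
      by (simp add: power_mult_distrib power_mult)
    ultimately have "(p $ 1 ^ r * p $ 2) ^ i * (p $ 1 ^ s * p $ 3) ^ j
        = p $ 1 ^ n * (p $ 1 ^ (r * i + s * j - n) * (p $ 2 ^ i * p $ 3 ^ j))"
      by (simp only: mult.assoc)
    then show ?thesis
      by (simp add: m g h_def distrib_left mult.left_commute)
  qed
  ultimately show ?case
    by blast
qed

lemma vector_coords: "(vector [p $ 1, p $ 2, p $ 3] :: complex ^ 3) = p"
  by (simp add: vec_eq_iff forall_3)

text \<open>
  All three components take the shape \<open>x\<^sup>n f(u,v)\<close> with an integer \<open>n\<close>, which lets a single
  derivative computation serve for the three rows of the Jacobian.
\<close>

lemma is_map_G_altdef:
  "is_map_G r s A B L G \<longleftrightarrow> polynomial_map G \<and>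
    (\<forall>p. p $ 1 \<noteq> 0 \<longrightarrow>
      G p $ 1 = p $ 1 powi (- int s) * eval2 A (p $ 1 ^ r * p $ 2) (p $ 1 ^ s * p $ 3) \<and>
      G p $ 2 = p $ 1 powi (- int r) * eval2 B (p $ 1 ^ r * p $ 2) (p $ 1 ^ s * p $ 3) \<and>
      G p $ 3 = p $ 1 powi 1 * eval2 L (p $ 1 ^ r * p $ 2) (p $ 1 ^ s * p $ 3))"
  (is "_ \<longleftrightarrow> _ \<and> (\<forall>p. _ \<longrightarrow> ?comps p)")
proof -
  have comps: "?comps p \<longleftrightarrow> (let u = p $ 1 ^ r * p $ 2; v = p $ 1 ^ s * p $ 3 in
      G (vector [p $ 1, p $ 2, p $ 3]) = vector
        [p $ 1 powi (- int s) * eval2 A u v, p $ 1 powi (- int r) * eval2 B u v, p $ 1 * eval2 L u v])"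
    for p
    unfolding vector_coords by (simp add: vec_eq_iff forall_3 Let_def)
  have all: "(\<forall>x y z. Q x y z) \<longleftrightarrow> (\<forall>p :: complex ^ 3. Q (p $ 1) (p $ 2) (p $ 3))"
    for Q :: "complex \<Rightarrow> complex \<Rightarrow> complex \<Rightarrow> bool"
  proof (intro iffI allI)
    fix x y z
    assume "\<forall>p :: complex ^ 3. Q (p $ 1) (p $ 2) (p $ 3)"
    from this[rule_format, of "vector [x, y, z]"] show "Q x y z"
      by simp
  qed simp
  show ?thesis
    unfolding is_map_G_def comps all ..
qed

lemma ex1_is_map_G:
  assumes "A \<in> V_A r s" and "B \<in> V_B r s"
  shows "\<exists>!G. is_map_G r s A B L G"
proof (rule ex_ex1I)
  obtain a where a: "polyfun a"
    "\<And>p. eval2 A (p $ 1 ^ r * p $ 2) (p $ 1 ^ s * p $ 3) = p $ 1 ^ s * a p"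
    using weighted_span_divisible assms(1) unfolding V_A_def by blast
  obtain b where b: "polyfun b"
    "\<And>p. eval2 B (p $ 1 ^ r * p $ 2) (p $ 1 ^ s * p $ 3) = p $ 1 ^ r * b p"
    using weighted_span_divisible assms(2) unfolding V_B_def by blast
  define l where "l p = p $ 1 * eval2 L (p $ 1 ^ r * p $ 2) (p $ 1 ^ s * p $ 3)"
    for p :: "complex ^ 3"
  have "polyfun l"
    unfolding l_def by (intro polyfun_mult polyfun_eval2 polyfun_power polyfun_coord)
  then have "polynomial_map (\<lambda>p. vector [a p, b p, l p])"
    using a(1) b(1) by (simp add: polynomial_map_iff_polyfun forall_3)
  then have "is_map_G r s A B L (\<lambda>p. vector [a p, b p, l p])"
    by (simp add: is_map_G_altdef a(2) b(2) l_def power_int_minus)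
  then show "\<exists>G. is_map_G r s A B L G"
    by blast
next
  fix G H
  assume GH: "is_map_G r s A B L G" "is_map_G r s A B L H"
  then have "polyfun (\<lambda>p. G p $ i)" "polyfun (\<lambda>p. H p $ i)" for i
    by (auto simp: is_map_G_altdef polynomial_map_iff_polyfun)
  moreover have "G p $ i = H p $ i" if "p $ 1 \<noteq> 0" for p i
    using GH that exhaust_3[of i] by (auto simp: is_map_G_altdef)
  ultimately have "G p $ i = H p $ i" for p i
    by (rule polyfun_eq_off_hyperplane)
  then show "G = H"
    by (simp add: fun_eq_iff vec_eq_iff)
qed

text \<open>
  The row of partial derivatives of \<open>x\<^sup>n f(u,v)\<close>, read off from the differential
  \<open>d(x\<^sup>n f) = x\<^sup>n (n f dx/x + f\<^sub>u du + f\<^sub>v dv)\<close> with \<open>du = r u dx/x + x\<^sup>r dy\<close> and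
  \<open>dv = s v dx/x + x\<^sup>s dz\<close>.
\<close>

lemma partial_derivatives_weighted:
  fixes p :: "complex ^ 3" and f :: "complex poly poly"
  assumes x: "p $ 1 \<noteq> 0"
    and F: "\<And>q. q $ 1 \<noteq> 0 \<Longrightarrow>
      F q = q $ 1 powi n * eval2 f (q $ 1 ^ r * q $ 2) (q $ 1 ^ s * q $ 3)"
  defines "u \<equiv> p $ 1 ^ r * p $ 2" and "v \<equiv> p $ 1 ^ s * p $ 3"
  shows "deriv (\<lambda>t. F (p + t *s axis 1 1)) 0 = p $ 1 powi n / p $ 1 *
      (of_int n * eval2 f u v + of_nat r * u * eval2 (du f) u v + of_nat s * v * eval2 (dv f) u v)"
    and "deriv (\<lambda>t. F (p + t *s axis 2 1)) 0 = p $ 1 powi n * p $ 1 ^ r * eval2 (du f) u v"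
    and "deriv (\<lambda>t. F (p + t *s axis 3 1)) 0 = p $ 1 powi n * p $ 1 ^ s * eval2 (dv f) u v"
proof -
  have der: "deriv (\<lambda>t. F (p + t *s axis j 1)) 0 =
      of_int n * (p $ 1 powi n / p $ 1) * axis j 1 $ 1 * eval2 f u v
      + p $ 1 powi n * (eval2 (du f) u v * (of_nat r * (p $ 1 ^ r / p $ 1) * axis j 1 $ 1 * p $ 2
            + p $ 1 ^ r * axis j 1 $ 2)
          + eval2 (dv f) u v * (of_nat s * (p $ 1 ^ s / p $ 1) * axis j 1 $ 1 * p $ 3
            + p $ 1 ^ s * axis j 1 $ 3))" (is "_ = ?D") for j
  proof -
    define q where "q t = p + t *s axis j 1" for t
    have q0: "q 0 = p"
      by (simp add: q_def vec_eq_iff)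
    have qi: "((\<lambda>t. q t $ i) has_field_derivative axis j 1 $ i) (at 0)" for i
      unfolding q_def by (auto intro!: derivative_eq_intros)
    have pow: "((\<lambda>t. q t $ 1 ^ k) has_field_derivative
        of_nat k * (p $ 1 ^ k / p $ 1) * axis j 1 $ 1) (at 0)" for k
      by (rule derivative_eq_intros qi refl)+ (use x in \<open>cases k; simp add: q0\<close>)
    have powi: "((\<lambda>t. q t $ 1 powi n) has_field_derivative
        of_int n * (p $ 1 powi n / p $ 1) * axis j 1 $ 1) (at 0)"
      by (rule derivative_eq_intros qi refl)+ (use x in \<open>simp_all add: q0 power_int_diff\<close>)
    have "((\<lambda>t. q t $ 1 powi n * eval2 f (q t $ 1 ^ r * q t $ 2) (q t $ 1 ^ s * q t $ 3))
        has_field_derivative ?D) (at 0)"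
      using DERIV_mult[OF powi has_field_derivative_eval2[of _ _ _ _ _ f,
            OF DERIV_mult[OF pow qi] DERIV_mult[OF pow qi]]]
      by (rule DERIV_cong) (simp add: q0 u_def v_def algebra_simps)
    moreover have "\<forall>\<^sub>F t in nhds 0.
        q t $ 1 powi n * eval2 f (q t $ 1 ^ r * q t $ 2) (q t $ 1 ^ s * q t $ 3) = F (q t)"
    proof -
      \<comment> \<open>A line through \<open>p\<close> stays off the plane \<open>x = 0\<close> for small times, so the formula for
        \<open>F\<close> may be differentiated.\<close>
      have "isCont (\<lambda>t. q t $ 1) 0"
        using qi by (rule DERIV_isCont)
      then have "((\<lambda>t. q t $ 1) \<longlongrightarrow> q 0 $ 1) (nhds 0)"
        unfolding isCont_def by (rule tendsto_at_iff_tendsto_nhds[THEN iffD1])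
      then have "\<forall>\<^sub>F t in nhds 0. q t $ 1 \<noteq> 0"
        using x by (intro tendsto_imp_eventually_ne) (simp_all add: q0)
      then show ?thesis
        by eventually_elim (simp add: F)
    qed
    ultimately have "((\<lambda>t. F (q t)) has_field_derivative ?D) (at 0)"
      by (subst DERIV_cong_ev[OF refl _ refl, symmetric])
    then show ?thesis
      unfolding q_def by (rule DERIV_imp_deriv)
  qed
  show "deriv (\<lambda>t. F (p + t *s axis 1 1)) 0 = p $ 1 powi n / p $ 1 *
      (of_int n * eval2 f u v + of_nat r * u * eval2 (du f) u v + of_nat s * v * eval2 (dv f) u v)"
    unfolding der by (simp add: axis_def u_def v_def algebra_simps)
  show "deriv (\<lambda>t. F (p + t *s axis 2 1)) 0 = p $ 1 powi n * p $ 1 ^ r * eval2 (du f) u v"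
    unfolding der by (simp add: axis_def)
  show "deriv (\<lambda>t. F (p + t *s axis 3 1)) 0 = p $ 1 powi n * p $ 1 ^ s * eval2 (dv f) u v"
    unfolding der by (simp add: axis_def)
qed

text \<open>
  The determinant of the three rows above: the powers of \<open>x\<close> cancel, and the multiples \<open>R\<close> and
  \<open>S\<close> of the second and third columns drop out of the first.
\<close>

lemma det_weighted_rows:
  fixes M :: "complex ^ 3 ^ 3"
  assumes x: "x \<noteq> 0"
    and M: "\<And>i. M $ i $ 1 = x powi (n i) / x * (of_int (n i) * f i + R * fu i + S * fv i)"
      "\<And>i. M $ i $ 2 = x powi (n i) * x ^ r * fu i" "\<And>i. M $ i $ 3 = x powi (n i) * x ^ s * fv i"
    and n: "n 1 = - int s" "n 2 = - int r" "n 3 = 1"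
  shows "det M = - (f 3 * (fu 2 * fv 1 - fv 2 * fu 1)
    + of_nat s * f 1 * (fu 2 * fv 3 - fv 2 * fu 3)
    + of_nat r * f 2 * (fu 3 * fv 1 - fv 3 * fu 1))"
proof -
  define c where "c i = of_int (n i) * f i" for i
  define w where "w i = x powi (n i)" for i
  have "det M = w 1 * w 2 * w 3 * x ^ r * x ^ s / x *
      (c 1 * (fu 2 * fv 3 - fv 2 * fu 3) + c 2 * (fu 3 * fv 1 - fv 3 * fu 1)
        + c 3 * (fu 1 * fv 2 - fv 1 * fu 2))"
    unfolding det_3 M c_def[symmetric] w_def[symmetric] using x
    by (simp add: divide_inverse) algebra
  also have "w 1 * w 2 * w 3 * x ^ r * x ^ s / x = 1"
    using x by (simp add: w_def n power_int_minus field_simps)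
  finally show ?thesis
    by (simp add: c_def n algebra_simps)
qed

lemma det_jacobian_matrix_map_G:
  assumes G: "is_map_G r s A B L G"
  shows "det (jacobian_matrix G p) =
    - eval2 (L * bracket B A + of_nat s * A * bracket B L + of_nat r * B * bracket L A)
        (p $ 1 ^ r * p $ 2) (p $ 1 ^ s * p $ 3)" (is "_ = - eval2 ?E _ _")
proof (rule polyfun_eq_off_hyperplane)
  show "polyfun (\<lambda>p. det (jacobian_matrix G p))"
    using G by (intro polyfun_det_jacobian_matrix) (simp add: is_map_G_altdef)
  show "polyfun (\<lambda>p. - eval2 ?E (p $ 1 ^ r * p $ 2) (p $ 1 ^ s * p $ 3))"
    by (intro polyfun_uminus polyfun_eval2 polyfun_mult polyfun_power polyfun_coord)
  fix p :: "complex ^ 3"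
  assume x: "p $ 1 \<noteq> 0"
  define n :: "3 \<Rightarrow> int" where "n = (\<lambda>i. if i = 1 then - int s else if i = 2 then - int r else 1)"
  define f where "f = (\<lambda>i :: 3. if i = 1 then A else if i = 2 then B else L)"
  have comp: "G q $ i = q $ 1 powi (n i) * eval2 (f i) (q $ 1 ^ r * q $ 2) (q $ 1 ^ s * q $ 3)"
    if "q $ 1 \<noteq> 0" for q i
    using G that exhaust_3[of i] by (auto simp: is_map_G_altdef n_def f_def)
  note partials = partial_derivatives_weighted[where F = "\<lambda>q. G q $ i" for i, OF x comp]
  show "det (jacobian_matrix G p) = - eval2 ?E (p $ 1 ^ r * p $ 2) (p $ 1 ^ s * p $ 3)"
    using det_weighted_rows[OF x, of "jacobian_matrix G p", unfolded jacobian_matrix_def vec_lambda_beta,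
        OF partials]
    by (simp add: jacobian_matrix_def n_def f_def bracket_def)
qed

theorem theorem8p3:
  fixes r s :: nat and A B \<Lambda> :: "complex poly poly"
  assumes "r > 0" and "s > 0"
  shows
    "bracket (B * \<Lambda> ^ r) (A * \<Lambda> ^ s) =
       \<Lambda> ^ (r + s - 1) *
         (\<Lambda> * bracket B A + of_nat s * A * bracket B \<Lambda> + of_nat r * B * bracket \<Lambda> A)
     \<and> (A \<in> V_A r s \<and> B \<in> V_B r s \<longrightarrow>
         (\<exists>!G. is_map_G r s A B \<Lambda> G) \<and>
         (\<forall>G. is_map_G r s A B \<Lambda> G \<longrightarrow>
           (keller_map G \<longleftrightarrow>
             (\<exists>\<kappa>. \<kappa> \<noteq> 0 \<and>
               \<Lambda> * bracket B A + of_nat s * A * bracket B \<Lambda> + of_nat r * B * bracket \<Lambda> A = [:[:\<kappa>:]:]))))"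
proof (intro conjI impI allI)
  let ?E = "\<Lambda> * bracket B A + of_nat s * A * bracket B \<Lambda> + of_nat r * B * bracket \<Lambda> A"
  show "bracket (B * \<Lambda> ^ r) (A * \<Lambda> ^ s) = \<Lambda> ^ (r + s - 1) * ?E"
    using assms by (rule bracket_mult_power)
  show "\<exists>!G. is_map_G r s A B \<Lambda> G" if "A \<in> V_A r s \<and> B \<in> V_B r s"
    using that by (simp add: ex1_is_map_G)
  fix G
  assume G: "is_map_G r s A B \<Lambda> G"
  note det = det_jacobian_matrix_map_G[OF G]
  show "keller_map G \<longleftrightarrow> (\<exists>\<kappa>. \<kappa> \<noteq> 0 \<and> ?E = [:[:\<kappa>:]:])"
  proof
    assume "keller_map G"
    then obtain c where c: "c \<noteq> 0" "\<And>p. det (jacobian_matrix G p) = c"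
      unfolding keller_map_def by blast
    have "?E = [:[:- c:]:]"
    proof (rule eval2_inject)
      fix u v
      show "eval2 ?E u v = eval2 [:[:- c:]:] u v"
        using det[of "vector [1, u, v]"] c(2) by (simp del: eval2_add eval2_mult)
    qed
    with c(1) show "\<exists>\<kappa>. \<kappa> \<noteq> 0 \<and> ?E = [:[:\<kappa>:]:]"
      by (intro exI[of _ "- c"]) simp
  next
    assume "\<exists>\<kappa>. \<kappa> \<noteq> 0 \<and> ?E = [:[:\<kappa>:]:]"
    then obtain \<kappa> where "\<kappa> \<noteq> 0" and E: "?E = [:[:\<kappa>:]:]"
      by blast
    then have "- \<kappa> \<noteq> 0 \<and> (\<forall>p. det (jacobian_matrix G p) = - \<kappa>)"
      unfolding det E by simp
    with G show "keller_map G"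
      unfolding keller_map_def is_map_G_altdef by blast
  qed
qed

end
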